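(* (Second form of the solution of the generalized Abel equation.) Let $x$ be a non-uniform lattice, $a,\gamma,\alpha\in\mathbb{C}$, and let $m$ be an integer with $0<m-1<\operatorname{Re}\alpha\le m$. Let $g:\{a+1,a+2,\dots\}\to\mathbb{C}$ and let $f:\{a-m+1,\dots,a,a+1,a+2,\dots\}\to\mathbb{C}$ satisfy $$\nabla_\gamma^{-\alpha}g(z)=f(z)\qquad(z\in\{a+1,a+2,\dots\}).$$ Then for all $z\in\{a+1,a+2,\dots\}$ $$g(z)=\sum_{k=0}^{m-1}\nabla_{\gamma+\alpha-k}^{k}f(a)\,\frac{[x_{\gamma-1}(z)-x_{\gamma-1}(a)]^{(-\alpha+k)}}{[\Gamma(-\alpha+k+1)]_q}+\nabla_{\gamma+\alpha-m}^{\alpha-m}\,\nabla_{\gamma+\alpha-m}^{m}f(z),$$ where $\nabla^k_{\gamma+\alpha-k}f(a)$ denotes the value of $\nabla^k_{\gamma+\alpha-k}f$ at $a$ (and $\nabla^0f=f$).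
   Context: Non-uniform lattice: a function $x:\mathbb{C}\to\mathbb{C}$ of one of the two forms (Q) $x(s)=\tilde c_1s^2+\tilde c_2s+\tilde c_3$ with $\tilde c_1\tilde c_2\neq0$, or (q) $x(s)=c_1q^{s}+c_2q^{-s}+c_3$ with $c_1c_2\ne0$, where $q\in\mathbb{C}\setminus\{0\}$, $|q|\neq1$, a value of $\log q$ is fixed and $q^s=e^{s\log q}$. For $\nu\in\mathbb{C}$, $x_\nu(s)=x(s+\nu/2)$. $\nabla F(s)=F(s)-F(s-1)$. Gamma functions: in case (Q), $[\Gamma(\alpha)]_q=\Gamma(\alpha)$. In case (q), $[\Gamma(\alpha)]_q=q^{-(\alpha-1)(\alpha-2)/4}\Gamma_q(\alpha)$, where $\Gamma_q(s)=\frac{\prod_{k\ge0}(1-q^{k+1})}{(1-q)^{s-1}\prod_{k\ge0}(1-q^{s+k})}$ for $|q|<1$ and $\Gamma_q(s)=q^{(s-1)(s-2)/2}\Gamma_{1/q}(s)$ for $|q|>1$. Generalized powers: for $S,Z,\mu\in\mathbb{C}$, in case (Q) with $c=\tilde c_2/\tilde c_1$, $[x(S)-x(Z)]^{(\mu)}=\tilde c_1^{\,\mu}\frac{\Gamma(S-Z+\mu)\Gamma(S+Z+c+1)}{\Gamma(S-Z)\Gamma(S+Z-\mu+c+1)}$; in case (q) with $c=\log(c_1/c_2)/\log q$, $[x(S)-x(Z)]^{(\mu)}=[c_2(1-q)^2]^{\mu}q^{-\mu S}\frac{\Gamma_q(S-Z+\mu)\Gamma_q(S+Z+c+1)}{\Gamma_q(S-Z)\Gamma_q(S+Z-\mu+c+1)}$.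 $[x_\nu(s)-x_\nu(t)]^{(\mu)}$ means this expression with $S=s+\nu/2$, $Z=t+\nu/2$. Complex powers of constants use fixed logarithms; $1/\Gamma$, $1/\Gamma_q$ are $0$ at poles. Differences: $\nabla_\gamma F(z)=\nabla F(z)/\nabla x_\gamma(z)$ and $\nabla_\gamma^kF(z)=\frac{\nabla}{\nabla x_\gamma(z)}\Big(\frac{\nabla}{\nabla x_{\gamma+1}(z)}\cdots\Big(\frac{\nabla F(z)}{\nabla x_{\gamma+k-1}(z)}\Big)\Big)$, $k=1,2,\dots$. Fractional sum (based at $a$): $$\nabla_\gamma^{-\alpha}h(z)=\frac1{[\Gamma(\alpha)]_q}\sum_{t=a+1}^{z}[x_{\gamma+\alpha-1}(z)-x_{\gamma+\alpha-1}(t-1)]^{(\alpha-1)}h(t)\,\nabla x_\gamma(t),\quad z\in\{a+1,a+2,\dots\};$$ the same formula is used for all exponents with $\operatorname{Re}\alpha\ge0$, $\alpha\neq0$, and $\nabla_\gamma^{0}$ is the identity. In particular $\nabla^{\alpha-m}_{\gamma+\alpha-m}$ is the fractional sum of order $m-\alpha$. Convention: all ($q$-)Gamma values occurring in numerators are assumed finite and all increments $\nabla x_\rho(s)$ occurring as denominators nonzero. *)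

theory Defs
  imports "HOL-Analysis.Analysis"
begin

text \<open>
  A non-uniform lattice is represented by its constants together with the values of the logarithms
  that have been fixed once and for all: the generalized powers and the q-Gamma function depend on
  these data and not only on the function \<open>x\<close>.

  \<^item> \<open>Quadratic c1 c2 c3 lc\<close> is \<open>x(s) = c1 s^2 + c2 s + c3\<close>, where \<open>lc\<close> is a logarithm of \<open>c1\<close>.
  \<^item> \<open>Q_Quadratic q lq c1 c2 c3 lr lc lp\<close> is \<open>x(s) = c1 q^s + c2 q^(-s) + c3\<close>, where \<open>lq\<close>, \<open>lr\<close>,
    \<open>lc\<close> are logarithms of \<open>q\<close>, \<open>c1/c2\<close>, \<open>c2 (1-q)^2\<close>, and \<open>lp\<close> is a logarithm of \<open>1 - p\<close>, with
    \<open>p\<close> the one of \<open>q\<close>, \<open>1/q\<close> that lies in the unit disc.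
\<close>

datatype lattice =
    Quadratic complex complex complex complex
  | Q_Quadratic complex complex complex complex complex complex complex complex

fun nonuniform_lattice :: "lattice \<Rightarrow> bool" where
  "nonuniform_lattice (Quadratic c1 c2 c3 lc) \<longleftrightarrow> c1 * c2 \<noteq> 0 \<and> exp lc = c1"
| "nonuniform_lattice (Q_Quadratic q lq c1 c2 c3 lr lc lp) \<longleftrightarrow>
     q \<noteq> 0 \<and> norm q \<noteq> 1 \<and> c1 * c2 \<noteq> 0 \<and>
     exp lq = q \<and> exp lr = c1 / c2 \<and> exp lc = c2 * (1 - q)\<^sup>2 \<and>
     exp lp = 1 - (if norm q < 1 then q else 1 / q)"

fun lattice_fun :: "lattice \<Rightarrow> complex \<Rightarrow> complex" where
  "lattice_fun (Quadratic c1 c2 c3 lc) s = c1 * s\<^sup>2 + c2 * s + c3"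
| "lattice_fun (Q_Quadratic q lq c1 c2 c3 lr lc lp) s = c1 * exp (s * lq) + c2 * exp (- s * lq) + c3"

definition shifted_lattice :: "lattice \<Rightarrow> complex \<Rightarrow> complex \<Rightarrow> complex" where
  "shifted_lattice X \<nu> s = lattice_fun X (s + \<nu> / 2)"

definition nabla :: "(complex \<Rightarrow> complex) \<Rightarrow> complex \<Rightarrow> complex" where
  "nabla F s = F s - F (s - 1)"

text \<open>
  In \<open>q_Gamma_disc lp l s\<close> the base is \<open>exp lp\<close>, of modulus less than 1, and \<open>l\<close> is a logarithm
  of \<open>1 - exp lp\<close>. For \<open>|q| > 1\<close> the base is \<open>1/q\<close>, whose logarithm is taken to be \<open>- log q\<close>.
  At a pole a factor of the product in the denominator vanishes; since \<open>x / 0 = 0\<close>, both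
  \<open>q_Gamma\<close> and \<open>1 / q_Gamma\<close> are \<open>0\<close> there, and likewise for the library's \<open>Gamma\<close>.
\<close>

definition q_Gamma_disc :: "complex \<Rightarrow> complex \<Rightarrow> complex \<Rightarrow> complex" where
  "q_Gamma_disc lp l s =
     (\<Prod>k. 1 - exp (of_nat (k + 1) * lp)) /
     (exp ((s - 1) * l) * (\<Prod>k. 1 - exp ((s + of_nat k) * lp)))"

definition q_Gamma :: "complex \<Rightarrow> complex \<Rightarrow> complex \<Rightarrow> complex" where
  "q_Gamma lq l s =
     (if norm (exp lq) < 1 then q_Gamma_disc lq l s
      else exp ((s - 1) * (s - 2) / 2 * lq) * q_Gamma_disc (- lq) l s)"

fun bracket_Gamma :: "lattice \<Rightarrow> complex \<Rightarrow> complex" where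
  "bracket_Gamma (Quadratic c1 c2 c3 lc) \<alpha> = Gamma \<alpha>"
| "bracket_Gamma (Q_Quadratic q lq c1 c2 c3 lr lc lp) \<alpha> =
     exp (- ((\<alpha> - 1) * (\<alpha> - 2) / 4) * lq) * q_Gamma lq lp \<alpha>"

fun lattice_shift :: "lattice \<Rightarrow> complex" where
  "lattice_shift (Quadratic c1 c2 c3 lc) = c2 / c1"
| "lattice_shift (Q_Quadratic q lq c1 c2 c3 lr lc lp) = lr / lq"

fun gen_power :: "lattice \<Rightarrow> complex \<Rightarrow> complex \<Rightarrow> complex \<Rightarrow> complex" where
  "gen_power (Quadratic c1 c2 c3 lc) S Z \<mu> =
     (let c = lattice_shift (Quadratic c1 c2 c3 lc) in
      exp (\<mu> * lc) *
      ((Gamma (S - Z + \<mu>) * Gamma (S + Z + c + 1)) /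
       (Gamma (S - Z) * Gamma (S + Z - \<mu> + c + 1))))"
| "gen_power (Q_Quadratic q lq c1 c2 c3 lr lc lp) S Z \<mu> =
     (let c = lattice_shift (Q_Quadratic q lq c1 c2 c3 lr lc lp); G = q_Gamma lq lp in
      exp (\<mu> * lc) * exp (- \<mu> * S * lq) *
      ((G (S - Z + \<mu>) * G (S + Z + c + 1)) /
       (G (S - Z) * G (S + Z - \<mu> + c + 1))))"

text \<open>\<open>[x\<^sub>\<nu>(s) - x\<^sub>\<nu>(t)]\<^sup>(\<^sup>\<mu>\<^sup>)\<close>\<close>

definition power_diff :: "lattice \<Rightarrow> complex \<Rightarrow> complex \<Rightarrow> complex \<Rightarrow> complex \<Rightarrow> complex" where
  "power_diff X \<nu> s t \<mu> = gen_power X (s + \<nu> / 2) (t + \<nu> / 2) \<mu>"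

definition nabla_quot :: "lattice \<Rightarrow> complex \<Rightarrow> (complex \<Rightarrow> complex) \<Rightarrow> complex \<Rightarrow> complex" where
  "nabla_quot X \<gamma> F z = nabla F z / nabla (shifted_lattice X \<gamma>) z"

text \<open>The outermost difference quotient is the one with index \<open>\<gamma>\<close>.\<close>

fun nabla_iter :: "lattice \<Rightarrow> complex \<Rightarrow> nat \<Rightarrow> (complex \<Rightarrow> complex) \<Rightarrow> complex \<Rightarrow> complex" where
  "nabla_iter X \<gamma> 0 F = F"
| "nabla_iter X \<gamma> (Suc k) F = nabla_quot X \<gamma> (nabla_iter X (\<gamma> + 1) k F)"

definition points_after :: "complex \<Rightarrow> complex set" where
  "points_after a = {a + of_nat n | n. n \<ge> 1}"

definition points_upto :: "complex \<Rightarrow> complex \<Rightarrow> complex set" where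
  "points_upto a z = {t \<in> points_after a. z - t \<in> \<nat>}"

text \<open>
  \<open>frac_sum X a \<gamma> \<alpha>\<close> is the operator \<open>\<nabla>\<^sub>\<gamma>\<close> with exponent \<open>-\<alpha>\<close>, based at \<open>a\<close>.
\<close>

definition frac_sum ::
    "lattice \<Rightarrow> complex \<Rightarrow> complex \<Rightarrow> complex \<Rightarrow> (complex \<Rightarrow> complex) \<Rightarrow> complex \<Rightarrow> complex" where
  "frac_sum X a \<gamma> \<alpha> h z =
     (if \<alpha> = 0 then h z
      else 1 / bracket_Gamma X \<alpha> *
        (\<Sum>t\<in>points_upto a z.
           power_diff X (\<gamma> + \<alpha> - 1) z (t - 1) (\<alpha> - 1) * h t * nabla (shifted_lattice X \<gamma>) t))"

text \<open>
  The predicates below express the standing convention: the Gamma (resp. q-Gamma) values in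
  numerators are finite and the increments of the lattice used as denominators do not vanish.
  \<open>Gamma_finite\<close> describes the complement of the poles of \<open>\<Gamma>\<close> resp. \<open>\<Gamma>\<^sub>q\<close>; note that
  \<open>q^(s+k) = 1\<close> is equivalent to \<open>(1/q)^(s+k) = 1\<close>.
\<close>

fun Gamma_finite :: "lattice \<Rightarrow> complex \<Rightarrow> bool" where
  "Gamma_finite (Quadratic c1 c2 c3 lc) s \<longleftrightarrow> s \<notin> \<int>\<^sub>\<le>\<^sub>0"
| "Gamma_finite (Q_Quadratic q lq c1 c2 c3 lr lc lp) s \<longleftrightarrow> (\<forall>k::nat. exp ((s + of_nat k) * lq) \<noteq> 1)"

definition gen_power_finite :: "lattice \<Rightarrow> complex \<Rightarrow> complex \<Rightarrow> complex \<Rightarrow> bool" where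
  "gen_power_finite X S Z \<mu> \<longleftrightarrow>
     Gamma_finite X (S - Z + \<mu>) \<and> Gamma_finite X (S + Z + lattice_shift X + 1)"

definition power_diff_finite :: "lattice \<Rightarrow> complex \<Rightarrow> complex \<Rightarrow> complex \<Rightarrow> complex \<Rightarrow> bool" where
  "power_diff_finite X \<nu> s t \<mu> \<longleftrightarrow> gen_power_finite X (s + \<nu> / 2) (t + \<nu> / 2) \<mu>"

definition frac_sum_finite :: "lattice \<Rightarrow> complex \<Rightarrow> complex \<Rightarrow> complex \<Rightarrow> complex \<Rightarrow> bool" where
  "frac_sum_finite X a \<gamma> \<alpha> z \<longleftrightarrow>
     \<alpha> = 0 \<or> (\<forall>t\<in>points_upto a z. power_diff_finite X (\<gamma> + \<alpha> - 1) z (t - 1) (\<alpha> - 1))"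

text \<open>
  All increments dividing in the evaluation of \<open>nabla_iter X \<gamma> k F\<close> at \<open>z\<close> are nonzero.
\<close>

fun nabla_iter_defined :: "lattice \<Rightarrow> complex \<Rightarrow> nat \<Rightarrow> complex \<Rightarrow> bool" where
  "nabla_iter_defined X \<gamma> 0 z \<longleftrightarrow> True"
| "nabla_iter_defined X \<gamma> (Suc k) z \<longleftrightarrow>
     nabla (shifted_lattice X \<gamma>) z \<noteq> 0 \<and>
     nabla_iter_defined X (\<gamma> + 1) k z \<and> nabla_iter_defined X (\<gamma> + 1) k (z - 1)"

end

theory Submission
  imports Defs
begin

text \<open>
  Both lattices obey one calculus: with \<open>w s = (1 - q^s) / (1 - q)\<close>, or \<open>w s = s\<close> in the quadratic
  case, where \<open>q = 1\<close>, one has \<open>w (s + t) = w s + q^s w t\<close>, and \<open>\<Gamma>(s + 1) = w s \<Gamma>(s)\<close> for the Gamma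
  function of the lattice. The fractional sums of order \<open>\<alpha>\<close> at \<open>\<gamma>\<close> and of order \<open>-\<alpha>\<close> at
  \<open>\<gamma> + \<alpha>\<close> are given by mutually inverse triangular matrices; the product of the two matrices is
  a very-well-poised sum that telescopes. Hence \<open>g\<close> is the sum of order \<open>-\<alpha>\<close> of \<open>f\<close>.
  In \<open>t\<close>, the normalized power \<open>[x(z) - x(t)]\<^sup>(\<^sup>\<mu>\<^sup>) / [\<Gamma>(\<mu> + 1)]\<close> has as difference quotient minus the
  normalized power of exponent \<open>\<mu> - 1\<close> at \<open>t - 1\<close>; so \<open>m\<close> summations by parts turn this sum into
  the right-hand side, each of them leaving one boundary term at \<open>a\<close>.
\<close>

subsection \<open>The q-Gamma function\<close>

lemma q_product_convergent:
  fixes lp s :: complex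
  assumes "norm (exp lp) < 1"
  shows "convergent_prod (\<lambda>k. 1 - exp ((s + of_nat k) * lp))"
proof -
  have "exp ((s + of_nat k) * lp) = exp (s * lp) * exp lp ^ k" for k
    by (simp add: ring_distribs exp_add exp_of_nat_mult)
  then have "norm (1 - exp ((s + of_nat k) * lp) - 1) = norm (exp (s * lp)) * norm (exp lp) ^ k" for k
    by (simp add: norm_mult norm_power)
  moreover have "summable (\<lambda>k. norm (exp (s * lp)) * norm (exp lp) ^ k)"
    using assms by (intro summable_mult summable_geometric) simp
  ultimately have "abs_convergent_prod (\<lambda>k. 1 - exp ((s + of_nat k) * lp))"
    unfolding abs_convergent_prod_conv_summable by simp
  then show ?thesis
    by (rule abs_convergent_prod_imp_convergent_prod)
qed

lemma q_product_eq_0_iff: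
  fixes lp s :: complex
  assumes "norm (exp lp) < 1"
  shows "(\<Prod>k. 1 - exp ((s + of_nat k) * lp)) = 0 \<longleftrightarrow> (\<exists>k::nat. exp ((s + of_nat k) * lp) = 1)"
  using has_prod_eq_0_iff[OF convergent_prod_has_prod[OF q_product_convergent[OF assms, of s]]]
  by (auto simp: image_iff)

lemma q_product_1_nonzero:
  fixes lp :: complex
  assumes "norm (exp lp) < 1"
  shows "(\<Prod>k. 1 - exp ((1 + of_nat k) * lp)) \<noteq> 0"
proof -
  have "Re lp < 0"
    using assms by (simp add: norm_exp_eq_Re)
  then have "norm (exp ((1 + of_nat k) * lp)) < 1" for k
    by (simp add: norm_exp_eq_Re mult_pos_neg)
  then have "exp ((1 + of_nat k) * lp) \<noteq> 1" for k
    by (metis norm_one less_irrefl)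
  then show ?thesis
    unfolding q_product_eq_0_iff[OF assms] by blast
qed

lemma q_Gamma_disc_eq_0_iff:
  assumes "norm (exp lp) < 1"
  shows "q_Gamma_disc lp l s = 0 \<longleftrightarrow> (\<exists>k::nat. exp ((s + of_nat k) * lp) = 1)"
  using q_product_1_nonzero[OF assms] q_product_eq_0_iff[OF assms, of s]
  by (simp add: q_Gamma_disc_def)

lemma q_Gamma_disc_1:
  assumes "norm (exp lp) < 1"
  shows "q_Gamma_disc lp l 1 = 1"
  using q_product_1_nonzero[OF assms] by (simp add: q_Gamma_disc_def)

lemma q_Gamma_disc_plus1:
  assumes "norm (exp lp) < 1" "exp l = 1 - exp lp" "\<forall>k::nat. exp ((s + of_nat k) * lp) \<noteq> 1"
  shows "q_Gamma_disc lp l (s + 1) = (1 - exp (s * lp)) / (1 - exp lp) * q_Gamma_disc lp l s"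
proof -
  have s: "exp (s * lp) \<noteq> 1"
    using assms(3)[rule_format, of 0] by simp
  have "(\<Prod>k. 1 - exp ((s + 1 + of_nat k) * lp)) = (\<Prod>k. 1 - exp ((s + of_nat (Suc k)) * lp))"
    by (simp add: add_ac)
  also have "\<dots> = (\<Prod>k. 1 - exp ((s + of_nat k) * lp)) / (1 - exp (s * lp))"
    using prodinf_split_head[OF q_product_convergent[OF assms(1), of s]] s by simp
  finally have "(\<Prod>k. 1 - exp ((s + 1 + of_nat k) * lp)) =
    (\<Prod>k. 1 - exp ((s + of_nat k) * lp)) / (1 - exp (s * lp))" .
  moreover have "exp (s * l) = exp ((s - 1) * l) * exp l"
    by (simp add: left_diff_distrib exp_diff)
  ultimately show ?thesis
    using s assms(2) by (simp add: q_Gamma_disc_def mult_ac)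
qed

text \<open>The bases q and 1/q lead to the same poles, so the case of q outside the unit disc can
  be read off from the lemmas about the disc.\<close>

lemma inverse_base_log:
  fixes lq s :: complex
  shows "exp (s * - lq) = 1 \<longleftrightarrow> exp (s * lq) = 1"
  by (simp add: exp_minus)

lemma q_Gamma_eq_0_iff:
  assumes "norm (exp lq) \<noteq> 1"
  shows "q_Gamma lq l s = 0 \<longleftrightarrow> (\<exists>k::nat. exp ((s + of_nat k) * lq) = 1)"
proof (cases "norm (exp lq) < 1")
  case True
  then show ?thesis
    by (simp add: q_Gamma_def q_Gamma_disc_eq_0_iff)
next
  case False
  with assms have "norm (exp (- lq)) < 1"
    by (simp add: norm_exp_eq_Re)
  from q_Gamma_disc_eq_0_iff[OF this, unfolded inverse_base_log] False show ?thesis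
    by (simp add: q_Gamma_def)
qed

lemma q_Gamma_1:
  assumes "norm (exp lq) \<noteq> 1"
  shows "q_Gamma lq l 1 = 1"
proof (cases "norm (exp lq) < 1")
  case True
  then show ?thesis
    by (simp add: q_Gamma_def q_Gamma_disc_1)
next
  case False
  with assms have "norm (exp (- lq)) < 1"
    by (simp add: norm_exp_eq_Re)
  with False show ?thesis
    by (simp add: q_Gamma_def q_Gamma_disc_1)
qed

lemma q_Gamma_plus1:
  assumes "norm (exp lq) \<noteq> 1"
    and "exp l = 1 - (if norm (exp lq) < 1 then exp lq else 1 / exp lq)"
    and "\<forall>k::nat. exp ((s + of_nat k) * lq) \<noteq> 1"
  shows "q_Gamma lq l (s + 1) = (1 - exp (s * lq)) / (1 - exp lq) * q_Gamma lq l s"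
proof (cases "norm (exp lq) < 1")
  case True
  then show ?thesis
    using assms by (simp add: q_Gamma_def q_Gamma_disc_plus1)
next
  case False
  with assms(1) have n: "norm (exp (- lq)) < 1"
    by (simp add: norm_exp_eq_Re)
  have q: "exp lq \<noteq> 1"
    using assms(1) by (metis norm_one)
  have "exp l = 1 - exp (- lq)"
    using False assms(2) by (simp add: exp_minus divide_inverse)
  with q_Gamma_disc_plus1[OF n, of l s, unfolded inverse_base_log] assms(3)
  have "q_Gamma_disc (- lq) l (s + 1) = (1 - exp (s * - lq)) / (1 - exp (- lq)) * q_Gamma_disc (- lq) l s"
    by simp
  also have "(1 - exp (s * - lq)) / (1 - exp (- lq)) =
      exp lq / exp (s * lq) * ((1 - exp (s * lq)) / (1 - exp lq))"
    using q by (simp add: exp_minus field_simps)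
  finally have "q_Gamma_disc (- lq) l (s + 1) =
      exp lq / exp (s * lq) * ((1 - exp (s * lq)) / (1 - exp lq)) * q_Gamma_disc (- lq) l s" .
  \<comment> \<open>From s to s + 1 the prefactor is multiplied by q^(s - 1), which cancels the
    factor q / q^s left by the change of base.\<close>
  moreover have "exp ((s - 1) * (s - 2) / 2 * lq) =
      exp ((s + 1 - 1) * (s + 1 - 2) / 2 * lq) * (exp lq / exp (s * lq))"
    unfolding exp_diff[symmetric] exp_add[symmetric]
    by (rule arg_cong[where f = exp]) (simp add: field_simps)
  ultimately have "exp ((s + 1 - 1) * (s + 1 - 2) / 2 * lq) * q_Gamma_disc (- lq) l (s + 1) =
      (1 - exp (s * lq)) / (1 - exp lq) * (exp ((s - 1) * (s - 2) / 2 * lq) * q_Gamma_disc (- lq) l s)"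
    by (simp only: mult_ac)
  with False show ?thesis
    by (simp only: q_Gamma_def if_False)
qed

subsection \<open>A common calculus for both lattices\<close>

text \<open>The logarithm of q. Its value 0 in the quadratic case turns every power of q into 1, so
  that one set of formulas serves both lattices.\<close>

fun base_log :: "lattice \<Rightarrow> complex" where
  "base_log (Quadratic c1 c2 c3 lc) = 0"
| "base_log (Q_Quadratic q lq c1 c2 c3 lr lc lp) = lq"

fun scale_log :: "lattice \<Rightarrow> complex" where
  "scale_log (Quadratic c1 c2 c3 lc) = lc"
| "scale_log (Q_Quadratic q lq c1 c2 c3 lr lc lp) = lc"

fun base_number :: "lattice \<Rightarrow> complex \<Rightarrow> complex" where
  "base_number (Quadratic c1 c2 c3 lc) s = s"
| "base_number (Q_Quadratic q lq c1 c2 c3 lr lc lp) s = (1 - exp (s * lq)) / (1 - q)"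

fun lattice_Gamma :: "lattice \<Rightarrow> complex \<Rightarrow> complex" where
  "lattice_Gamma (Quadratic c1 c2 c3 lc) s = Gamma s"
| "lattice_Gamma (Q_Quadratic q lq c1 c2 c3 lr lc lp) s = q_Gamma lq lp s"

locale nonuniform =
  fixes X :: lattice
  assumes nonuniform: "nonuniform_lattice X"
begin

abbreviation e where "e s \<equiv> exp (s * base_log X)"
abbreviation w where "w \<equiv> base_number X"
abbreviation G where "G \<equiv> lattice_Gamma X"
abbreviation fin where "fin \<equiv> Gamma_finite X"
abbreviation c where "c \<equiv> lattice_shift X"
abbreviation lc where "lc \<equiv> scale_log X"

lemma w_add: "w (s + t) = w s + e s * w t"
proof (cases X)
  case (Q_Quadratic q lq c1 c2 c3 lr lc lp)
  then show ?thesis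
    by (simp add: add_divide_distrib[symmetric] ring_distribs exp_add)
qed simp

lemma w_0: "w 0 = 0"
  by (cases X) simp_all

lemma w_1: "w 1 = 1"
  using nonuniform by (cases X) auto

text \<open>Compare the expansions of w (s + 1) and w (1 + s). Powers of q are thus affine in
  \<open>w\<close>, and identities that mix \<open>e\<close> and \<open>w\<close> become polynomial
  identities.\<close>

lemma e_eq_w: "e s = 1 + (e 1 - 1) * w s"
  using w_add[of s 1] w_add[of 1 s] by (simp add: w_1 algebra_simps)

lemma fin_plus1: "fin s \<Longrightarrow> fin (s + 1)"
proof (cases X)
  case (Quadratic c1 c2 c3 lc)
  assume "fin s"
  with Quadratic show "fin (s + 1)"
    using plus_one_in_nonpos_Ints_imp by auto
next
  case (Q_Quadratic q lq c1 c2 c3 lr lc lp)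
  assume "fin s"
  with Q_Quadratic have "exp ((s + of_nat (Suc k)) * lq) \<noteq> 1" for k
    by (metis Gamma_finite.simps(2))
  with Q_Quadratic show "fin (s + 1)"
    by (simp add: add_ac)
qed

lemma fin_plus_nat: "fin s \<Longrightarrow> fin (s + of_nat n)"
proof (induction n)
  case (Suc n)
  then show ?case
    using fin_plus1[of "s + of_nat n"] by (simp add: add_ac)
qed simp

lemma w_nonzero: "fin s \<Longrightarrow> w s \<noteq> 0"
proof (cases X)
  case (Q_Quadratic q lq c1 c2 c3 lr lc lp)
  assume "fin s"
  with Q_Quadratic have "exp ((s + of_nat 0) * lq) \<noteq> 1"
    by (metis Gamma_finite.simps(2))
  with Q_Quadratic nonuniform show ?thesis
    by auto
qed auto

text \<open>Neither Gamma function has a genuine zero; the value 0 only occurs as the default at a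
  pole.\<close>

lemma G_eq_0_iff: "G s = 0 \<longleftrightarrow> \<not> fin s"
proof (cases X)
  case (Quadratic c1 c2 c3 lc)
  then show ?thesis by (simp add: Gamma_eq_zero_iff)
next
  case (Q_Quadratic q lq c1 c2 c3 lr lc lp)
  with nonuniform have "norm (exp lq) \<noteq> 1"
    by auto
  with Q_Quadratic show ?thesis by (simp add: q_Gamma_eq_0_iff)
qed

lemma G_1: "G 1 = 1"
proof (cases X)
  case (Q_Quadratic q lq c1 c2 c3 lr lc lp)
  with nonuniform have "norm (exp lq) \<noteq> 1"
    by auto
  with Q_Quadratic show ?thesis by (simp add: q_Gamma_1)
qed simp

lemma fin_1: "fin 1"
  using G_1 G_eq_0_iff[of 1] by simp

lemma w_Suc_nonzero: "w (of_nat (Suc n)) \<noteq> 0"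
  using w_nonzero[OF fin_plus_nat[OF fin_1, of n]] by simp

lemma G_plus1: "fin s \<Longrightarrow> G (s + 1) = w s * G s"
proof (cases X)
  case (Quadratic c1 c2 c3 lc)
  assume "fin s"
  with Quadratic show ?thesis by (simp add: Gamma_plus1)
next
  case (Q_Quadratic q lq c1 c2 c3 lr lc lp)
  assume "fin s"
  with Q_Quadratic nonuniform show ?thesis
    using q_Gamma_plus1[of lq lp s] by simp
qed

text \<open>At a pole of \<open>G\<close> the junk value \<open>G s = 0\<close> makes \<open>1 / G s\<close> the correct value \<open>0\<close>,
  so that the functional equation of \<open>1 / G\<close> holds without exception.\<close>

lemma inverse_G_eq: "inverse (G s) = w s * inverse (G (s + 1))"
proof (cases "fin s")
  case True
  then show ?thesis
    using G_plus1[of s] w_nonzero[of s] by simp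
next
  case False
  \<comment> \<open>If s is a pole and s + 1 is not, only k = 0 can witness the pole: s = 0,
    respectively q^s = 1.\<close>
  have "w s = 0" if "fin (s + 1)"
  proof (cases X)
    case (Quadratic c1 c2 c3 lc)
    with False obtain n where n: "s = - of_nat n"
      by (auto elim: nonpos_Ints_cases')
    have "n = 0"
    proof (rule ccontr)
      assume "n \<noteq> 0"
      with n have "s + 1 = - of_nat (n - 1)"
        by (simp add: of_nat_diff)
      with that Quadratic show False
        by simp
    qed
    with n Quadratic show ?thesis by simp
  next
    case (Q_Quadratic q lq c1 c2 c3 lr lc lp)
    with False obtain k :: nat where k: "exp ((s + of_nat k) * lq) = 1"
      by auto
    have "k = 0"
    proof (rule ccontr)
      assume "k \<noteq> 0"
      then obtain j where "k = Suc j"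
        using not0_implies_Suc by blast
      with that Q_Quadratic k show False
        by (auto simp: add_ac)
    qed
    with k Q_Quadratic show ?thesis by simp
  qed
  then show ?thesis
    using False G_eq_0_iff[of s] G_eq_0_iff[of "s + 1"] by auto
qed

text \<open>This is what the constant \<open>c\<close> is made for: each increment is an exponential
  factor times a single value of \<open>w\<close>, so it can be absorbed by the functional equation
  of \<open>G\<close>.\<close>

lemma nabla_shifted_lattice:
  "nabla (shifted_lattice X \<nu>) s = exp lc * e (- (s + \<nu> / 2)) * w (2 * s + \<nu> - 1 + c)"
proof (cases X)
  case (Quadratic c1 c2 c3 lc)
  with nonuniform have "c1 \<noteq> 0" "exp lc = c1"
    by auto
  with Quadratic show ?thesis
    by (simp add: nabla_def shifted_lattice_def field_simps power2_eq_square)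
next
  case (Q_Quadratic q lq c1 c2 c3 lr lc lp)
  with nonuniform have q: "exp lq = q" "q \<noteq> 0" "q \<noteq> 1" "lq \<noteq> 0" and c: "c2 \<noteq> 0" "exp lr = c1 / c2"
    "exp lc = c2 * (1 - q)\<^sup>2"
    by auto
  define y where "y = exp ((s + \<nu> / 2) * lq)"
  have y: "y \<noteq> 0"
    by (simp add: y_def)
  have "exp ((s + \<nu> / 2 - 1) * lq) = y / q"
    by (simp add: y_def left_diff_distrib exp_diff q)
  moreover have "exp (- (s + \<nu> / 2) * lq) = 1 / y"
    by (simp add: y_def exp_minus field_simps)
  moreover have "exp (- (s + \<nu> / 2 - 1) * lq) = q / y"
    using exp_minus[of "(s + \<nu> / 2 - 1) * lq"] \<open>exp ((s + \<nu> / 2 - 1) * lq) = y / q\<close>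
    by (simp only: minus_mult_left inverse_divide)
  \<comment> \<open>Here q^c = c1 / c2 because c = \<open>lr / lq\<close>; the quotient is
    meaningful since q is not 1.\<close>
  moreover have "exp ((2 * s + \<nu> - 1 + lr / lq) * lq) = y\<^sup>2 / q * (c1 / c2)"
  proof -
    have "(2 * s + \<nu> - 1 + lr / lq) * lq = (s + \<nu> / 2) * lq + (s + \<nu> / 2) * lq - lq + lr"
      using q(4) by (simp add: field_simps)
    then show ?thesis
      by (simp only: exp_add exp_diff q c y_def power2_eq_square times_divide_eq_left)
  qed
  ultimately show ?thesis
    using Q_Quadratic y q(2,3) c
    by (simp add: nabla_def shifted_lattice_def y_def[symmetric] diff_add_eq power2_eq_square)
      (simp add: field_simps)
qed

lemma gen_power_eq:
  "gen_power X S Z \<mu> = exp (\<mu> * lc) * e (- \<mu> * S) *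
     ((G (S - Z + \<mu>) * G (S + Z + c + 1)) / (G (S - Z) * G (S + Z - \<mu> + c + 1)))"
  by (cases X) (simp_all add: Let_def)

lemma bracket_Gamma_eq: "bracket_Gamma X \<alpha> = e (- ((\<alpha> - 1) * (\<alpha> - 2) / 4)) * G \<alpha>"
  by (cases X) simp_all

subsection \<open>Normalized powers\<close>

lemma e_add: "e (s + t) = e s * e t"
  by (simp add: ring_distribs exp_add)

text \<open>In q-Pochhammer notation (q^\<mu>; q)_j / (q; q)_j, and for the quadratic lattice the
  coefficient of t^j in (1 - t)^(-\<mu>).\<close>

definition qbin :: "complex \<Rightarrow> nat \<Rightarrow> complex" where
  "qbin \<mu> j = (\<Prod>r<j. w (\<mu> + of_nat r) / w (of_nat (Suc r)))"

lemma qbin_0 [simp]: "qbin \<mu> 0 = 1"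
  by (simp add: qbin_def)

lemma qbin_Suc: "w (of_nat (Suc j)) * qbin \<mu> (Suc j) = qbin \<mu> j * w (\<mu> + of_nat j)"
  using w_Suc_nonzero[of j] by (simp add: qbin_def del: of_nat_Suc)

text \<open>Splits off the first factor of the numerator, where \<open>qbin_Suc\<close> splits off
  the last one.\<close>

lemma qbin_plus1: "w (of_nat (Suc j)) * qbin \<mu> (Suc j) = w \<mu> * qbin (\<mu> + 1) j"
proof (induction j)
  case 0
  then show ?case by (simp add: qbin_def w_1)
next
  case (Suc j)
  have "w (of_nat (Suc (Suc j))) * (w (of_nat (Suc j)) * qbin \<mu> (Suc (Suc j))) =
    (w (of_nat (Suc j)) * qbin \<mu> (Suc j)) * w (\<mu> + of_nat (Suc j))"
    by (simp only: qbin_Suc[of "Suc j"] mult.left_commute mult.assoc mult.commute)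
  also have "\<dots> = w \<mu> * (qbin (\<mu> + 1) j * w (\<mu> + 1 + of_nat j))"
    unfolding Suc by (simp add: add_ac mult_ac)
  also have "\<dots> = w (of_nat (Suc j)) * (w \<mu> * qbin (\<mu> + 1) (Suc j))"
    by (simp only: qbin_Suc[symmetric] mult.left_commute)
  finally show ?case
    using w_Suc_nonzero[of j] by simp
qed

text \<open>The induction moves units from j to \<mu>, which keeps \<mu> + j fixed; hence finiteness
  at this one point suffices, and \<open>inverse_G_eq\<close> takes care of poles at \<mu>.\<close>

lemma qbin_G:
  assumes "fin (\<mu> + of_nat j)"
  shows "G (\<mu> + of_nat j) * inverse (G \<mu>) * inverse (G (of_nat (Suc j))) = qbin \<mu> j"
  using assms
proof (induction j arbitrary: \<mu>)
  case 0
  then show ?case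
    using G_eq_0_iff[of \<mu>] by (simp add: G_1)
next
  case (Suc j)
  have "inverse (G (of_nat (Suc j))) = w (of_nat (Suc j)) * inverse (G (of_nat (Suc (Suc j))))"
    using inverse_G_eq[of "of_nat (Suc j)"] by (simp add: add_ac)
  then have "w (of_nat (Suc j)) *
      (G (\<mu> + of_nat (Suc j)) * inverse (G \<mu>) * inverse (G (of_nat (Suc (Suc j))))) =
      w \<mu> * (G (\<mu> + 1 + of_nat j) * inverse (G (\<mu> + 1)) * inverse (G (of_nat (Suc j))))"
    using inverse_G_eq[of \<mu>] by (simp add: add_ac mult_ac)
  also have "\<dots> = w \<mu> * qbin (\<mu> + 1) j"
    using Suc.IH[of "\<mu> + 1"] Suc.prems by (simp add: add_ac)
  finally show ?case
    using qbin_plus1[of j \<mu>] w_Suc_nonzero[of j] by (metis mult_left_cancel)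
qed

text \<open>\<open>norm_power \<nu> z j \<mu>\<close> stands for \<open>[x\<^sub>\<nu>(z) - x\<^sub>\<nu>(z - j)]\<^sup>(\<^sup>\<mu>\<^sup>) / [\<Gamma>(\<mu> + 1)]\<close>. The quotient
  \<open>\<Gamma>(\<mu> + j) / (\<Gamma>(\<mu> + 1) \<Gamma>(j))\<close> is replaced by the finite product that continues it to the
  poles, so that the identities below hold for every \<open>\<mu>\<close>.\<close>

definition norm_power :: "complex \<Rightarrow> complex \<Rightarrow> nat \<Rightarrow> complex \<Rightarrow> complex" where
  "norm_power \<nu> z j \<mu> =
     exp (\<mu> * lc) * e (- \<mu> * (z + \<nu> / 2) + \<mu> * (\<mu> - 1) / 4) *
     (if j = 0 then 0 else qbin (\<mu> + 1) (j - 1)) *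
     (G (2 * z - of_nat j + \<nu> + c + 1) * inverse (G (2 * z - of_nat j + \<nu> + c + 1 - \<mu>)))"

lemma fin_0: "\<not> fin 0"
  using w_nonzero[of 0] w_0 by auto

lemma power_diff_eq_norm_power:
  assumes "power_diff_finite X \<nu> z t \<mu>" and "z - t = of_nat j"
  shows "power_diff X \<nu> z t \<mu> / bracket_Gamma X (\<mu> + 1) = norm_power \<nu> z j \<mu>"
proof -
  have t: "t = z - of_nat j"
    using assms(2) by (simp add: algebra_simps)
  have fin: "fin (of_nat j + \<mu>)"
    using assms(1) by (simp add: power_diff_finite_def gen_power_finite_def t)
  have *: "G (of_nat j + \<mu>) * inverse (G (of_nat j)) * inverse (G (\<mu> + 1)) =
      (if j = 0 then 0 else qbin (\<mu> + 1) (j - 1))"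
  proof (cases j)
    \<comment> \<open>For t = z the default value of 1 / G 0 is 0, in agreement with the clause for
      j = 0 in \<open>norm_power\<close>.\<close>
    case 0
    then show ?thesis
      using fin_0 G_eq_0_iff[of 0] by simp
  next
    case (Suc i)
    then show ?thesis
      using qbin_G[of "\<mu> + 1" i] fin by (simp add: add_ac mult_ac)
  qed
  have "power_diff X \<nu> z t \<mu> = exp (\<mu> * lc) * e (- \<mu> * (z + \<nu> / 2)) *
      (G (of_nat j + \<mu>) * inverse (G (of_nat j))) *
      (G (2 * z - of_nat j + \<nu> + c + 1) * inverse (G (2 * z - of_nat j + \<nu> + c + 1 - \<mu>)))"
  proof -
    have "z + \<nu> / 2 - (t + \<nu> / 2) = of_nat j"
      "z + \<nu> / 2 + (t + \<nu> / 2) = 2 * z - of_nat j + \<nu>"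
      "2 * z - of_nat j + \<nu> - \<mu> + c + 1 = 2 * z - of_nat j + \<nu> + c + 1 - \<mu>"
      by (simp_all add: t)
    then show ?thesis
      unfolding power_diff_def gen_power_eq by (simp only: divide_inverse inverse_mult_distrib mult_ac)
  qed
  moreover have "inverse (bracket_Gamma X (\<mu> + 1)) = e (\<mu> * (\<mu> - 1) / 4) * inverse (G (\<mu> + 1))"
    by (simp add: bracket_Gamma_eq exp_minus)
  ultimately show ?thesis
    unfolding norm_power_def *[symmetric] e_add divide_inverse by (simp only: mult_ac)
qed

lemma w_diff: "e s * w (t - s) = w t - w s"
  using w_add[of s "t - s"] by simp

text \<open>All three powers share the factor E * P. What remains after dividing it out is
  \<open>key\<close>, an identity between products of values of \<open>w\<close>.\<close>

lemma norm_power_diff: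
  assumes "fin (2 * z - of_nat j + \<nu> + c)"
  shows "norm_power \<nu> z (Suc j) \<mu> - norm_power \<nu> z j \<mu> =
    nabla (shifted_lattice X (\<nu> + 1 - \<mu>)) (z - of_nat j) * norm_power \<nu> z (Suc j) (\<mu> - 1)"
proof -
  \<comment> \<open>The argument of \<open>w\<close> in the increment on the right-hand
    side.\<close>
  define \<rho> where "\<rho> = 2 * z - of_nat j + \<nu> + c - \<mu> - of_nat j"
  define J where "J = complex_of_nat j"
  define Q where "Q = (if j = 0 then 0 else qbin (\<mu> + 1) (j - 1))"
  define E where "E = exp (\<mu> * lc) * e (- \<mu> * (z + \<nu> / 2) + \<mu> * (\<mu> - 1) / 4)"
  define P where "P = G (\<rho> + \<mu> + J) * inverse (G (\<rho> + J + 1))"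
  have fin: "fin (\<rho> + \<mu> + J)"
    using assms by (simp add: \<rho>_def J_def algebra_simps)
  have E: "exp lc * e (- (z - of_nat j + (\<nu> + 1 - \<mu>) / 2)) *
      (exp ((\<mu> - 1) * lc) * e (- (\<mu> - 1) * (z + \<nu> / 2) + (\<mu> - 1) * (\<mu> - 1 - 1) / 4)) = E * e J"
  proof -
    have 1: "exp lc * exp ((\<mu> - 1) * lc) = exp (\<mu> * lc)"
      unfolding exp_add[symmetric] by (simp add: algebra_simps)
    have 2: "e (- (z - of_nat j + (\<nu> + 1 - \<mu>) / 2)) *
        e (- (\<mu> - 1) * (z + \<nu> / 2) + (\<mu> - 1) * (\<mu> - 1 - 1) / 4) =
        e (- \<mu> * (z + \<nu> / 2) + \<mu> * (\<mu> - 1) / 4) * e J"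
      unfolding e_add[symmetric] J_def
      by (rule arg_cong[where f = "\<lambda>s. e s"]) (simp add: field_simps)
    show ?thesis
      using arg_cong2[OF 1 2, of "(*)"] unfolding E_def by (simp only: mult_ac)
  qed
  have key: "w (\<rho> + J) * qbin (\<mu> + 1) j - w (\<rho> + \<mu> + J) * Q = e J * w \<rho> * qbin \<mu> j"
  proof (cases j)
    case 0
    then show ?thesis
      by (simp add: Q_def J_def)
  next
    case (Suc i)
    have "w J * qbin (\<mu> + 1) j = qbin (\<mu> + 1) i * w (\<mu> + J)"
      using qbin_Suc[of i "\<mu> + 1"] by (simp add: Suc J_def add_ac)
    \<comment> \<open>Multiplication by w J makes all three coefficients multiples of
      \<open>qbin (\<mu> + 1) i\<close>.\<close>
    moreover have "w J * qbin \<mu> j = w \<mu> * qbin (\<mu> + 1) i"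
      using qbin_plus1[of i \<mu>] by (simp add: Suc J_def)
    moreover have "w (\<rho> + J) * w (\<mu> + J) - w (\<rho> + \<mu> + J) * w J = e J * w \<rho> * w \<mu>"
      unfolding w_add e_add e_eq_w[of \<rho>] e_eq_w[of \<mu>] e_eq_w[of J] by algebra
    ultimately have "w J * (w (\<rho> + J) * qbin (\<mu> + 1) j - w (\<rho> + \<mu> + J) * qbin (\<mu> + 1) i) =
      w J * (e J * w \<rho> * qbin \<mu> j)"
      by algebra
    moreover have "w J \<noteq> 0"
      using w_Suc_nonzero[of i] by (simp add: J_def Suc)
    ultimately show ?thesis
      by (simp add: Q_def Suc)
  qed
  have L1: "norm_power \<nu> z (Suc j) \<mu> = E * P * (w (\<rho> + J) * qbin (\<mu> + 1) j)"
  proof -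
    have "2 * z - of_nat (Suc j) + \<nu> + c + 1 = \<rho> + \<mu> + J"
      "2 * z - of_nat (Suc j) + \<nu> + c + 1 - \<mu> = \<rho> + J"
      by (simp_all add: \<rho>_def J_def)
    then show ?thesis
      using inverse_G_eq[of "\<rho> + J"] unfolding norm_power_def E_def P_def by simp
  qed
  have L2: "norm_power \<nu> z j \<mu> = E * P * (w (\<rho> + \<mu> + J) * Q)"
  proof -
    have args: "2 * z - of_nat j + \<nu> + c + 1 = \<rho> + \<mu> + J + 1"
      "2 * z - of_nat j + \<nu> + c + 1 - \<mu> = \<rho> + J + 1"
      by (simp_all add: \<rho>_def J_def)
    then show ?thesis
      unfolding norm_power_def args G_plus1[OF fin] E_def P_def Q_def by (simp only: mult_ac)
  qed
  have R: "nabla (shifted_lattice X (\<nu> + 1 - \<mu>)) (z - of_nat j) * norm_power \<nu> z (Suc j) (\<mu> - 1) =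
    E * P * (e J * w \<rho> * qbin \<mu> j)"
  proof -
    have 1: "2 * z - of_nat (Suc j) + \<nu> + c + 1 = \<rho> + \<mu> + J"
      "\<rho> + \<mu> + J - (\<mu> - 1) = \<rho> + J + 1"
      "2 * (z - of_nat j) + (\<nu> + 1 - \<mu>) - 1 + c = \<rho>"
      by (simp_all add: \<rho>_def J_def algebra_simps)
    show ?thesis
      using E unfolding nabla_shifted_lattice norm_power_def P_def 1
      by (simp only: nat.distinct if_False diff_Suc_1 diff_add_cancel) algebra
  qed
  show ?thesis
    unfolding L1 L2 R key[symmetric] by (simp add: algebra_simps)
qed

subsection \<open>Inversion of the fractional sum\<close>

text \<open>In hypergeometric terms this is the indefinite summation of a very-well-poised series with
  parameters \<open>A; B, C, D\<close> such that \<open>A = B + C + D\<close>, here \<open>\<beta> + \<alpha>; \<alpha>, \<beta> + N, - N\<close> with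
  \<open>N = k + d\<close>.\<close>

lemma telescoping_term:
  fixes \<alpha> \<beta> :: complex and k d :: nat
  defines "k' \<equiv> of_nat k" and "d' \<equiv> of_nat d"
  assumes "fin (\<beta> + k' + d' + k')" and "fin (\<beta> + \<alpha> + k')"
  shows "w \<alpha> * w (k' + d') * w (\<beta> + k' + d') *
      (e (- \<alpha> * k') * qbin \<alpha> k * qbin (- \<alpha>) d * w (\<beta> + \<alpha> + 2 * k') *
       (G (\<beta> + k' + d' + k') * inverse (G (\<beta> + \<alpha> + k' + d' + k' + 1)) *
        (G (\<beta> + \<alpha> + k') * inverse (G (\<beta> + k' + 1))))) =
    e (- \<alpha> * k') * (w (of_nat (Suc k)) * qbin \<alpha> (Suc k)) * (w d' * qbin (- \<alpha>) d) *
      (G (\<beta> + k' + d' + k' + 1) * inverse (G (\<beta> + \<alpha> + k' + d' + k' + 1)) *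
       (G (\<beta> + \<alpha> + k' + 1) * inverse (G (\<beta> + k' + 1)))) -
    e (- \<alpha> * (k' - 1)) * (w k' * qbin \<alpha> k) * (w (of_nat (Suc d)) * qbin (- \<alpha>) (Suc d)) *
      (G (\<beta> + k' + d' + k') * inverse (G (\<beta> + \<alpha> + k' + d' + k')) *
       (G (\<beta> + \<alpha> + k') * inverse (G (\<beta> + k'))))"
proof -
  \<comment> \<open>The identity left over when the functional equations have brought all values of
    \<open>G\<close> and \<open>qbin\<close> to the arguments of the left-hand side.\<close>
  have poly: "w (\<alpha> + k') * w d' * w (\<beta> + k' + d' + k') * w (\<beta> + \<alpha> + k')
      - (w d' - w \<alpha>) * w k' * w (\<beta> + k') * w (\<beta> + \<alpha> + k' + d' + k')
    = w \<alpha> * w (k' + d') * w (\<beta> + k' + d') * w (\<beta> + \<alpha> + 2 * k')"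
    unfolding w_add e_add mult_2 e_eq_w[of \<alpha>] e_eq_w[of k'] e_eq_w[of d'] e_eq_w[of \<beta>]
    by algebra
  have e1: "e (- \<alpha> * (k' - 1)) = e (- \<alpha> * k') * e \<alpha>"
    unfolding e_add[symmetric] by (rule arg_cong[where f = "\<lambda>s. e s"]) (simp add: algebra_simps)
  have w1: "e \<alpha> * w (d' - \<alpha>) = w d' - w \<alpha>"
    by (rule w_diff)
  have q1: "w (of_nat (Suc k)) * qbin \<alpha> (Suc k) = qbin \<alpha> k * w (\<alpha> + k')"
    unfolding k'_def by (rule qbin_Suc)
  have q2: "w (of_nat (Suc d)) * qbin (- \<alpha>) (Suc d) = qbin (- \<alpha>) d * w (d' - \<alpha>)"
    using qbin_Suc[of d "- \<alpha>"] by (simp add: d'_def)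
  note G1 = G_plus1[OF assms(3)] G_plus1[OF assms(4)]
  note G2 = inverse_G_eq[of "\<beta> + \<alpha> + k' + d' + k'"] inverse_G_eq[of "\<beta> + k'"]
  show ?thesis
    unfolding q1 q2 G1 G2 e1 using poly w1 by algebra
qed

text \<open>Up to a common factor, these are the off-diagonal entries of the product of the two
  matrices. The multiplier in \<open>telescoping_term\<close> is the same for all k and nonzero
  under these assumptions, so it can be cancelled.\<close>

lemma orthogonality_sum:
  fixes \<alpha> \<beta> :: complex and N :: nat
  assumes "N > 0" and "fin \<alpha>" and "fin (\<beta> + of_nat N)" and "fin (\<beta> + \<alpha>)"
  shows "(\<Sum>k\<le>N. e (- \<alpha> * of_nat k) * qbin \<alpha> k * qbin (- \<alpha>) (N - k) * w (\<beta> + \<alpha> + 2 * of_nat k) *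
       (G (\<beta> + of_nat N + of_nat k) * inverse (G (\<beta> + \<alpha> + of_nat N + of_nat k + 1)) *
        (G (\<beta> + \<alpha> + of_nat k) * inverse (G (\<beta> + of_nat k + 1))))) = 0"
    (is "(\<Sum>k\<le>N. ?t k) = 0")
proof -
  \<comment> \<open>The subtracted term of \<open>telescoping_term\<close> for d = N - k. The factor
    w k makes V 0 vanish, and w (Suc N - k) makes V (Suc N) vanish.\<close>
  define V where "V k = e (- \<alpha> * (of_nat k - 1)) * (w (of_nat k) * qbin \<alpha> k) *
      (w (of_nat (Suc N - k)) * qbin (- \<alpha>) (Suc N - k)) *
      (G (\<beta> + of_nat N + of_nat k) * inverse (G (\<beta> + \<alpha> + of_nat N + of_nat k)) *
       (G (\<beta> + \<alpha> + of_nat k) * inverse (G (\<beta> + of_nat k))))" for k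
  have "w \<alpha> * w (of_nat N) * w (\<beta> + of_nat N) * ?t k = V (Suc k) - V k" if "k \<le> N" for k
  proof -
    obtain d where N: "N = k + d"
      using \<open>k \<le> N\<close> le_Suc_ex by blast
    have "fin (\<beta> + of_nat k + of_nat d + of_nat k)" "fin (\<beta> + \<alpha> + of_nat k)"
      using fin_plus_nat[OF assms(3), of k] fin_plus_nat[OF assms(4), of k]
      by (simp_all add: N add_ac)
    from telescoping_term[OF this] show ?thesis
      by (simp add: V_def N Suc_diff_le add_ac del: of_nat_Suc) (simp add: add_ac)
  qed
  then have "w \<alpha> * w (of_nat N) * w (\<beta> + of_nat N) * (\<Sum>k\<le>N. ?t k) = (\<Sum>k\<le>N. V (Suc k) - V k)"
    unfolding sum_distrib_left by (intro sum.cong) auto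
  also have "\<dots> = V (Suc N) - V 0"
    using sum_lessThan_telescope[of V "Suc N"] by (simp only: lessThan_Suc_atMost)
  also have "\<dots> = 0"
    by (simp add: V_def w_0)
  finally show ?thesis
    using w_nonzero[OF assms(2)] w_nonzero[OF assms(3)] w_Suc_nonzero[of "N - 1"] assms(1) by simp
qed

text \<open>The weight of \<open>h (z - j)\<close> in the fractional sum of order \<open>\<alpha>\<close> of \<open>h\<close> at \<open>z\<close>, again
  continued to every \<open>\<alpha>\<close>; at \<open>\<alpha> = 0\<close> it is the kernel of the identity.\<close>

definition frac_kernel :: "complex \<Rightarrow> complex \<Rightarrow> complex \<Rightarrow> nat \<Rightarrow> complex" where
  "frac_kernel \<gamma> \<alpha> z j =
     norm_power (\<gamma> + \<alpha> - 1) z (Suc j) (\<alpha> - 1) * nabla (shifted_lattice X \<gamma>) (z - of_nat j)"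

lemma frac_kernel_eq:
  "frac_kernel \<gamma> \<alpha> z j =
     exp (\<alpha> * lc) * e (of_nat j - \<alpha> * z - \<alpha> * (\<gamma> - 1) / 2 - \<alpha> * (\<alpha> + 1) / 4) * qbin \<alpha> j *
     (G (2 * z - of_nat j + \<gamma> + c + \<alpha> - 1) * inverse (G (2 * z - of_nat j + \<gamma> + c))) *
     w (2 * z - 2 * of_nat j + \<gamma> + c - 1)"
proof -
  have E1: "exp ((\<alpha> - 1) * lc) * exp lc = exp (\<alpha> * lc)"
    unfolding exp_add[symmetric] by (simp add: algebra_simps)
  have E2: "e (- (\<alpha> - 1) * (z + (\<gamma> + \<alpha> - 1) / 2) + (\<alpha> - 1) * (\<alpha> - 1 - 1) / 4) *
      e (- (z - of_nat j + \<gamma> / 2)) =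
      e (of_nat j - \<alpha> * z - \<alpha> * (\<gamma> - 1) / 2 - \<alpha> * (\<alpha> + 1) / 4)"
    unfolding e_add[symmetric] by (rule arg_cong[where f = "\<lambda>s. e s"]) (simp add: field_simps)
  have args: "2 * z - of_nat (Suc j) + (\<gamma> + \<alpha> - 1) + c + 1 = 2 * z - of_nat j + \<gamma> + c + \<alpha> - 1"
    "2 * z - of_nat j + \<gamma> + c + \<alpha> - 1 - (\<alpha> - 1) = 2 * z - of_nat j + \<gamma> + c"
    "2 * (z - of_nat j) + \<gamma> - 1 + c = 2 * z - 2 * of_nat j + \<gamma> + c - 1"
    by simp_all
  show ?thesis
    unfolding frac_kernel_def norm_power_def nabla_shifted_lattice args E1[symmetric] E2[symmetric]
    by (simp only: nat.distinct if_False diff_Suc_1 diff_add_cancel mult_ac)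
qed

text \<open>With i = l + k the summand is a factor independent of k times the summand of
  \<open>orthogonality_sum\<close>. This settles l < n; for l = n the single term is evaluated
  directly.\<close>

lemma frac_kernel_inverse:
  fixes a \<gamma> \<alpha> :: complex and l n :: nat
  defines "b \<equiv> 2 * a + \<gamma> + c"
  assumes "l \<le> n" and "fin \<alpha>" and "fin (b + of_nat l + of_nat n - 1)"
    and "fin (b + \<alpha> + 2 * of_nat l - 1)"
  shows "(\<Sum>i=l..n. frac_kernel (\<gamma> + \<alpha>) (- \<alpha>) (a + of_nat n) (n - i) *
      frac_kernel \<gamma> \<alpha> (a + of_nat i) (i - l)) = (if l = n then 1 else 0)"
proof -
  define N where "N = n - l"
  define \<beta> where "\<beta> = b + 2 * of_nat l - 1"
  have n: "n = l + N"
    using \<open>l \<le> n\<close> by (simp add: N_def)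
  \<comment> \<open>Collects the part of both exponents that does not depend on k; for N = 0 its
    exponent is 0.\<close>
  define E where "E = e (of_nat N - of_nat l * \<alpha> + \<alpha> * (a + of_nat n)
      + \<alpha> * (\<gamma> + \<alpha> - 1) / 2 + \<alpha> * (1 - \<alpha>) / 4 - \<alpha> * a - \<alpha> * (\<gamma> - 1) / 2 - \<alpha> * (\<alpha> + 1) / 4)"
  have term_eq: "frac_kernel (\<gamma> + \<alpha>) (- \<alpha>) (a + of_nat n) (N - k) * frac_kernel \<gamma> \<alpha> (a + of_nat (k + l)) k =
    E * w \<beta> * (e (- \<alpha> * of_nat k) * qbin \<alpha> k * qbin (- \<alpha>) (N - k) * w (\<beta> + \<alpha> + 2 * of_nat k) *
       (G (\<beta> + of_nat N + of_nat k) * inverse (G (\<beta> + \<alpha> + of_nat N + of_nat k + 1)) *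
        (G (\<beta> + \<alpha> + of_nat k) * inverse (G (\<beta> + of_nat k + 1)))))" if "k \<le> N" for k
  proof -
    obtain d where N: "N = k + d"
      using \<open>k \<le> N\<close> le_Suc_ex by blast
    have args: "\<beta> + \<alpha> + of_nat N + of_nat k + 1 + - \<alpha> - 1 = \<beta> + of_nat N + of_nat k"
      "2 * (a + of_nat n) - of_nat d + (\<gamma> + \<alpha>) + c = \<beta> + \<alpha> + of_nat N + of_nat k + 1"
      "2 * (a + of_nat n) - 2 * of_nat d + (\<gamma> + \<alpha>) + c - 1 = \<beta> + \<alpha> + 2 * of_nat k"
      "\<beta> + of_nat k + 1 + \<alpha> - 1 = \<beta> + \<alpha> + of_nat k"
      "2 * (a + of_nat (k + l)) - of_nat k + \<gamma> + c = \<beta> + of_nat k + 1"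
      "2 * (a + of_nat (k + l)) - 2 * of_nat k + \<gamma> + c - 1 = \<beta>"
      by (simp_all add: \<beta>_def b_def n N algebra_simps)
    have "exp (- \<alpha> * lc) * exp (\<alpha> * lc) = 1"
      by (simp add: exp_minus)
    moreover have "e (of_nat d - - \<alpha> * (a + of_nat n) - - \<alpha> * (\<gamma> + \<alpha> - 1) / 2 - - \<alpha> * (- \<alpha> + 1) / 4) *
      e (of_nat k - \<alpha> * (a + of_nat (k + l)) - \<alpha> * (\<gamma> - 1) / 2 - \<alpha> * (\<alpha> + 1) / 4) =
      E * e (- \<alpha> * of_nat k)"
      unfolding e_add[symmetric] E_def
      by (rule arg_cong[where f = "\<lambda>s. e s"]) (simp add: field_simps N)
    moreover have d: "N - k = d"
      by (simp add: N)
    ultimately show ?thesis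
      unfolding frac_kernel_eq d args by algebra
  qed
  have shift: "(\<Sum>i=l..n. frac_kernel (\<gamma> + \<alpha>) (- \<alpha>) (a + of_nat n) (n - i) *
      frac_kernel \<gamma> \<alpha> (a + of_nat i) (i - l)) =
    (\<Sum>k\<le>N. frac_kernel (\<gamma> + \<alpha>) (- \<alpha>) (a + of_nat n) (N - k) *
      frac_kernel \<gamma> \<alpha> (a + of_nat (k + l)) k)"
    using sum.shift_bounds_cl_nat_ivl[of "\<lambda>i. frac_kernel (\<gamma> + \<alpha>) (- \<alpha>) (a + of_nat n) (n - i) *
      frac_kernel \<gamma> \<alpha> (a + of_nat i) (i - l)" 0 l N]
    by (simp add: n atLeast0AtMost add_ac)
  have f1: "fin (\<beta> + of_nat N)" and f2: "fin (\<beta> + \<alpha>)"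
    using assms(4,5) by (simp_all add: \<beta>_def n algebra_simps)
  show ?thesis
  proof (cases "N = 0")
    case False
    then have sum_0: "(\<Sum>k\<le>N. e (- \<alpha> * of_nat k) * qbin \<alpha> k * qbin (- \<alpha>) (N - k) * w (\<beta> + \<alpha> + 2 * of_nat k) *
       (G (\<beta> + of_nat N + of_nat k) * inverse (G (\<beta> + \<alpha> + of_nat N + of_nat k + 1)) *
        (G (\<beta> + \<alpha> + of_nat k) * inverse (G (\<beta> + of_nat k + 1))))) = 0"
      using orthogonality_sum[OF _ \<open>fin \<alpha>\<close> f1 f2] by simp
    have "(\<Sum>k\<le>N. frac_kernel (\<gamma> + \<alpha>) (- \<alpha>) (a + of_nat n) (N - k) *
      frac_kernel \<gamma> \<alpha> (a + of_nat (k + l)) k) = E * w \<beta> * 0"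
      unfolding sum_0[symmetric] sum_distrib_left
      by (rule sum.cong[OF refl], rule term_eq) simp
    then show ?thesis
      unfolding shift using False by (simp add: n)
  next
    case True
    have "E = e 0"
      unfolding E_def True n by (rule arg_cong[where f = "\<lambda>s. e s"]) (simp add: field_simps)
    moreover have "G \<beta> \<noteq> 0" "G (\<beta> + \<alpha>) \<noteq> 0" "w \<beta> \<noteq> 0" "w (\<beta> + \<alpha>) \<noteq> 0"
      "G (\<beta> + 1) = w \<beta> * G \<beta>" "G (\<beta> + \<alpha> + 1) = w (\<beta> + \<alpha>) * G (\<beta> + \<alpha>)"
      using f1 f2 True G_eq_0_iff w_nonzero G_plus1 by simp_all
    ultimately show ?thesis
      unfolding shift using term_eq[of 0] True n by (simp add: field_simps)
  qed
qed

end

section \<open>Fractional sums on the points after a as products with triangular matrices\<close>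

lemma nabla_iter_defined_nonzero:
  assumes "nabla_iter_defined X \<rho> m z" and "j < m"
  shows "nabla (shifted_lattice X (\<rho> + of_nat j)) z \<noteq> 0"
  using assms
proof (induction m arbitrary: \<rho> j)
  case (Suc m)
  show ?case
  proof (cases j)
    case 0
    with Suc.prems show ?thesis by simp
  next
    case (Suc i)
    with Suc.IH[of "\<rho> + 1" i] Suc.prems show ?thesis by (simp add: add_ac)
  qed
qed simp

lemma sum_points_upto:
  "sum h (points_upto a (a + of_nat n)) = (\<Sum>i=1..n. h (a + of_nat i))"
proof -
  have "points_upto a (a + of_nat n) = (\<lambda>i. a + of_nat i) ` {1..n}"
  proof (intro equalityI subsetI)
    fix t assume "t \<in> points_upto a (a + of_nat n)"
    then obtain i k :: nat where "t = a + of_nat i" "i \<ge> 1" "a + of_nat n - t = of_nat k"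
      by (auto simp: points_upto_def points_after_def Nats_def)
    then have "complex_of_nat n = of_nat (i + k)"
      by (simp add: algebra_simps)
    then have "n = i + k"
      unfolding of_nat_eq_iff .
    with \<open>t = _\<close> \<open>i \<ge> 1\<close> show "t \<in> (\<lambda>i. a + of_nat i) ` {1..n}"
      by auto
  next
    fix t assume "t \<in> (\<lambda>i. a + of_nat i) ` {1..n}"
    then obtain i where i: "t = a + of_nat i" "i \<in> {1..n}"
      by blast
    then have "a + of_nat n - t = of_nat (n - i)"
      by (simp add: of_nat_diff)
    then have "a + of_nat n - t \<in> \<nat>"
      by simp
    with i show "t \<in> points_upto a (a + of_nat n)"
      unfolding points_upto_def points_after_def by auto
  qed
  moreover have "inj_on (\<lambda>i. a + complex_of_nat i) {1..n}"
    by (simp add: inj_on_def)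
  ultimately show ?thesis
    by (simp add: sum.reindex)
qed

lemma points_upto_mem:
  assumes "i \<in> {1..n}"
  shows "a + of_nat i \<in> points_upto a (a + of_nat n)"
proof -
  have "a + of_nat n - (a + of_nat i) = of_nat (n - i)"
    using assms by (simp add: of_nat_diff)
  then have "a + of_nat n - (a + of_nat i) \<in> \<nat>"
    by (metis of_nat_in_Nats)
  with assms show ?thesis
    unfolding points_upto_def points_after_def by auto
qed

context nonuniform
begin

text \<open>The exponent 0 is treated apart, since \<open>frac_sum\<close> is then the identity by
  definition. It arises in the remainder term when \<alpha> = m. The kernel is then the identity
  matrix, provided that its diagonal meets no pole.\<close>

lemma frac_sum_eq_kernel_sum:
  assumes fs: "frac_sum_finite X a \<gamma> \<alpha> (a + of_nat n)" and "n \<ge> 1"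
    and z: "\<alpha> = 0 \<Longrightarrow> fin (2 * (a + of_nat n) + \<gamma> + c - 1)"
  shows "frac_sum X a \<gamma> \<alpha> h (a + of_nat n) =
    (\<Sum>i=1..n. frac_kernel \<gamma> \<alpha> (a + of_nat n) (n - i) * h (a + of_nat i))"
proof (cases "\<alpha> = 0")
  case True
  \<comment> \<open>The first factor of the numerator is w 0.\<close>
  have "qbin 0 (Suc j) = 0" for j
    using qbin_plus1[of j 0] w_Suc_nonzero[of j] by (simp add: w_0)
  then have "frac_kernel \<gamma> \<alpha> (a + of_nat n) (n - i) * h (a + of_nat i) =
      (if i = n then h (a + of_nat n) else 0)" if "i \<in> {1..n}" for i
  proof (cases "i = n")
    case True
    define u where "u = 2 * (a + of_nat n) + \<gamma> + c - 1"
    have "fin u"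
      using z[OF \<open>\<alpha> = 0\<close>] by (simp add: u_def)
    then have "G u * inverse (G (u + 1)) * w u = 1"
      using G_plus1[of u] w_nonzero[of u] G_eq_0_iff[of u] by (simp add: divide_simps)
    moreover have "frac_kernel \<gamma> 0 (a + of_nat n) 0 = G u * inverse (G (u + 1)) * w u"
      by (simp add: frac_kernel_eq u_def)
    ultimately show ?thesis
      using True \<open>\<alpha> = 0\<close> by simp
  next
    case False
    with that have "n - i = Suc (n - i - 1)"
      by auto
    with \<open>\<And>j. qbin 0 (Suc j) = 0\<close> have "qbin 0 (n - i) = 0"
      by metis
    with False \<open>\<alpha> = 0\<close> show ?thesis
      by (simp add: frac_kernel_eq)
  qed
  then have "(\<Sum>i=1..n. frac_kernel \<gamma> \<alpha> (a + of_nat n) (n - i) * h (a + of_nat i)) =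
      (\<Sum>i=1..n. if i = n then h (a + of_nat n) else 0)"
    by (rule sum.cong[OF refl])
  with True \<open>n \<ge> 1\<close> show ?thesis
    by (simp add: frac_sum_def)
next
  case False
  have np: "power_diff X (\<gamma> + \<alpha> - 1) (a + of_nat n) (a + of_nat i - 1) (\<alpha> - 1) / bracket_Gamma X \<alpha> =
      norm_power (\<gamma> + \<alpha> - 1) (a + of_nat n) (Suc (n - i)) (\<alpha> - 1)" if "i \<in> {1..n}" for i
  proof -
    have "power_diff_finite X (\<gamma> + \<alpha> - 1) (a + of_nat n) (a + of_nat i - 1) (\<alpha> - 1)"
      using fs False points_upto_mem[OF that, of a] by (auto simp: frac_sum_finite_def)
    moreover have "a + of_nat n - (a + of_nat i - 1) = of_nat (Suc (n - i))"
      using that by (simp add: of_nat_diff)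
    ultimately show ?thesis
      using power_diff_eq_norm_power[of "\<gamma> + \<alpha> - 1" "a + of_nat n" "a + of_nat i - 1" "\<alpha> - 1"] by simp
  qed
  have pt: "a + of_nat n - of_nat (n - i) = a + of_nat i" if "i \<in> {1..n}" for i
    using that by (simp add: of_nat_diff)
  have tm: "1 / bracket_Gamma X \<alpha> *
      (power_diff X (\<gamma> + \<alpha> - 1) (a + of_nat n) (a + of_nat i - 1) (\<alpha> - 1) * h (a + of_nat i) *
       nabla (shifted_lattice X \<gamma>) (a + of_nat i)) =
      frac_kernel \<gamma> \<alpha> (a + of_nat n) (n - i) * h (a + of_nat i)" if "i \<in> {1..n}" for i
    unfolding frac_kernel_def np[OF that, symmetric] pt[OF that] by simp
  show ?thesis
    unfolding frac_sum_def sum_points_upto sum_distrib_left if_not_P[OF False]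
    by (rule sum.cong[OF refl], rule tm)
qed

text \<open>Insert the expression for f and exchange the two sums over l \<le> i: the inner sum
  becomes an entry of the identity matrix.\<close>

lemma kernel_sum_inverse:
  assumes "n \<ge> 1" and "fin \<alpha>" and "fin (2 * a + of_nat n + \<gamma> + c)"
    and "\<And>l. l \<in> {1..n} \<Longrightarrow> fin (2 * a + 2 * of_nat l + \<gamma> + \<alpha> + c - 1)"
    and "\<And>i. i \<in> {1..n} \<Longrightarrow> f (a + of_nat i) =
      (\<Sum>l=1..i. frac_kernel \<gamma> \<alpha> (a + of_nat i) (i - l) * g (a + of_nat l))"
  shows "(\<Sum>i=1..n. frac_kernel (\<gamma> + \<alpha>) (- \<alpha>) (a + of_nat n) (n - i) * f (a + of_nat i)) =
    g (a + of_nat n)"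
proof -
  let ?B = "\<lambda>i. frac_kernel (\<gamma> + \<alpha>) (- \<alpha>) (a + of_nat n) (n - i)"
  let ?A = "\<lambda>i l. frac_kernel \<gamma> \<alpha> (a + of_nat i) (i - l)"
  have orth: "(\<Sum>i=l..n. ?B i * ?A i l) = (if l = n then 1 else 0)" if "l \<in> {1..n}" for l
  proof (rule frac_kernel_inverse)
    show "l \<le> n" "fin \<alpha>"
      using that assms(2) by auto
    show "fin (2 * a + \<gamma> + c + of_nat l + of_nat n - 1)"
      using fin_plus_nat[OF assms(3), of "l - 1"] that by (simp add: of_nat_diff algebra_simps)
    show "fin (2 * a + \<gamma> + c + \<alpha> + 2 * of_nat l - 1)"
      using assms(4)[OF that] by (simp add: algebra_simps)
  qed
  have "(\<Sum>i=1..n. ?B i * f (a + of_nat i)) =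
      (\<Sum>i\<in>{1..n}. \<Sum>l\<in>{l\<in>{1..n}. l \<le> i}. ?B i * ?A i l * g (a + of_nat l))"
  proof (rule sum.cong[OF refl])
    fix i assume "i \<in> {1..n}"
    moreover from this have "{l\<in>{1..n}. l \<le> i} = {1..i}"
      by auto
    ultimately show "?B i * f (a + of_nat i) =
        (\<Sum>l\<in>{l\<in>{1..n}. l \<le> i}. ?B i * ?A i l * g (a + of_nat l))"
      by (simp add: assms(5) sum_distrib_left mult.assoc)
  qed
  also have "\<dots> = (\<Sum>l\<in>{1..n}. \<Sum>i\<in>{i\<in>{1..n}. l \<le> i}. ?B i * ?A i l * g (a + of_nat l))"
    by (rule sum.swap_restrict) auto
  also have "\<dots> = (\<Sum>l\<in>{1..n}. if l = n then g (a + of_nat n) else 0)"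
  proof (rule sum.cong[OF refl])
    fix l assume l: "l \<in> {1..n}"
    then have "{i\<in>{1..n}. l \<le> i} = {l..n}"
      by auto
    with orth[OF l] show "(\<Sum>i\<in>{i\<in>{1..n}. l \<le> i}. ?B i * ?A i l * g (a + of_nat l)) =
        (if l = n then g (a + of_nat n) else 0)"
      by (simp flip: sum_distrib_right)
  qed
  also have "\<dots> = g (a + of_nat n)"
    using \<open>n \<ge> 1\<close> by simp
  finally show ?thesis .
qed

subsection \<open>Summation by parts\<close>

text \<open>The kernel at \<rho>, \<mu> is a difference of values P j by
  \<open>norm_power_diff\<close>. The kernel at \<rho> - 1, \<mu> + 1 involves the same P, as \<rho>
  + \<mu> is unchanged, and its increment cancels the denominator of
  \<open>nabla_quot\<close>.\<close>

lemma kernel_sum_by_parts: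
  assumes "fin (2 * a + of_nat n + \<rho> + \<mu> + c)"
    and "\<And>i. i \<in> {1..n} \<Longrightarrow> nabla (shifted_lattice X (\<rho> - 1)) (a + of_nat i) \<noteq> 0"
  shows "(\<Sum>i=1..n. frac_kernel \<rho> \<mu> (a + of_nat n) (n - i) * F (a + of_nat i)) =
    F a * norm_power (\<rho> + \<mu> - 1) (a + of_nat n) n \<mu> +
    (\<Sum>i=1..n. frac_kernel (\<rho> - 1) (\<mu> + 1) (a + of_nat n) (n - i) *
       nabla_quot X (\<rho> - 1) F (a + of_nat i))"
proof -
  define P where "P j = norm_power (\<rho> + \<mu> - 1) (a + of_nat n) j \<mu>" for j
  define T where "T i = P (n - i) * F (a + of_nat i)" for i
  have L: "frac_kernel \<rho> \<mu> (a + of_nat n) (n - i) = P (Suc (n - i)) - P (n - i)"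
    if "i \<in> {1..n}" for i
  proof -
    have "fin (2 * (a + of_nat n) - of_nat (n - i) + (\<rho> + \<mu> - 1) + c)"
      using fin_plus_nat[OF assms(1), of "i - 1"] that by (simp add: of_nat_diff algebra_simps)
    from norm_power_diff[OF this, of \<mu>] show ?thesis
      by (simp add: P_def frac_kernel_def)
  qed
  have R: "frac_kernel (\<rho> - 1) (\<mu> + 1) (a + of_nat n) (n - i) * nabla_quot X (\<rho> - 1) F (a + of_nat i) =
      P (Suc (n - i)) * (F (a + of_nat i) - F (a + of_nat i - 1))" if "i \<in> {1..n}" for i
  proof -
    have 1: "a + of_nat n - of_nat (n - i) = a + of_nat i"
      using that by (simp add: of_nat_diff)
    have 2: "\<rho> - 1 + (\<mu> + 1) - 1 = \<rho> + \<mu> - 1"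
      by simp
    show ?thesis
      using assms(2)[OF that] unfolding frac_kernel_def P_def nabla_quot_def 1 2
      by (simp add: nabla_def[of F])
  qed
  have "(\<Sum>i=1..n. (P (Suc (n - i)) - P (n - i)) * F (a + of_nat i)) -
      (\<Sum>i=1..n. P (Suc (n - i)) * (F (a + of_nat i) - F (a + of_nat i - 1))) =
      (\<Sum>i=1..n. T (i - 1) - T i)"
    unfolding sum_subtractf[symmetric]
  proof (rule sum.cong[OF refl])
    fix i assume "i \<in> {1..n}"
    then have "n - (i - 1) = Suc (n - i)" "a + of_nat (i - 1) = a + of_nat i - 1"
      by (auto simp: of_nat_diff)
    then show "(P (Suc (n - i)) - P (n - i)) * F (a + of_nat i) -
        P (Suc (n - i)) * (F (a + of_nat i) - F (a + of_nat i - 1)) = T (i - 1) - T i"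
      by (simp add: T_def algebra_simps)
  qed
  also have "\<dots> = T 0 - T n"
    unfolding One_nat_def sum.atLeast1_atMost_eq by (simp add: sum_lessThan_telescope')
  \<comment> \<open>The upper boundary term T n vanishes because \<open>norm_power\<close> is 0 for
    j = 0.\<close>
  also have "\<dots> = F a * P n"
    by (simp add: T_def P_def norm_power_def)
  also have "(\<Sum>i=1..n. (P (Suc (n - i)) - P (n - i)) * F (a + of_nat i)) =
      (\<Sum>i=1..n. frac_kernel \<rho> \<mu> (a + of_nat n) (n - i) * F (a + of_nat i))"
    by (rule sum.cong[OF refl]) (simp only: L)
  also have "(\<Sum>i=1..n. P (Suc (n - i)) * (F (a + of_nat i) - F (a + of_nat i - 1))) =
      (\<Sum>i=1..n. frac_kernel (\<rho> - 1) (\<mu> + 1) (a + of_nat n) (n - i) *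
         nabla_quot X (\<rho> - 1) F (a + of_nat i))"
    by (rule sum.cong[OF refl]) (simp only: R)
  finally show ?thesis
    unfolding P_def by (simp only: diff_eq_eq)
qed

text \<open>Summation by parts repeated k times; the case k = m produces all the boundary terms
  together with the remainder.\<close>

lemma kernel_sum_Taylor:
  assumes "fin (2 * a + of_nat n + \<gamma> + c)"
    and "\<And>i. i \<in> {1..n} \<Longrightarrow> nabla_iter_defined X (\<gamma> + \<alpha> - of_nat m) m (a + of_nat i)"
    and "k \<le> m"
  shows "(\<Sum>i=1..n. frac_kernel (\<gamma> + \<alpha>) (- \<alpha>) (a + of_nat n) (n - i) * f (a + of_nat i)) =
    (\<Sum>r<k. nabla_iter X (\<gamma> + \<alpha> - of_nat r) r f a *
       norm_power (\<gamma> - 1) (a + of_nat n) n (- \<alpha> + of_nat r)) +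
    (\<Sum>i=1..n. frac_kernel (\<gamma> + \<alpha> - of_nat k) (of_nat k - \<alpha>) (a + of_nat n) (n - i) *
       nabla_iter X (\<gamma> + \<alpha> - of_nat k) k f (a + of_nat i))"
  using \<open>k \<le> m\<close>
proof (induction k)
  case (Suc k)
  let ?\<rho> = "\<gamma> + \<alpha> - of_nat k" and ?\<mu> = "of_nat k - \<alpha>"
  have fin: "fin (2 * a + of_nat n + ?\<rho> + ?\<mu> + c)"
    using assms(1) by (simp add: algebra_simps)
  have nz: "nabla (shifted_lattice X (?\<rho> - 1)) (a + of_nat i) \<noteq> 0" if "i \<in> {1..n}" for i
  proof -
    \<comment> \<open>The increment dividing in this step is one of those that divide in the m-th
      difference, the one with offset m - Suc k.\<close>
    have "\<gamma> + \<alpha> - of_nat m + of_nat (m - Suc k) = ?\<rho> - 1"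
      using Suc.prems by (simp add: of_nat_diff)
    with nabla_iter_defined_nonzero[OF assms(2)[OF that], of "m - Suc k"] Suc.prems show ?thesis
      by (metis diff_less zero_less_Suc less_le_trans)
  qed
  have args: "?\<rho> + ?\<mu> - 1 = \<gamma> - 1" "?\<rho> - 1 = \<gamma> + \<alpha> - of_nat (Suc k)"
    "?\<mu> + 1 = of_nat (Suc k) - \<alpha>" "?\<mu> = - \<alpha> + of_nat k"
    by simp_all
  have iter: "nabla_quot X (\<gamma> + \<alpha> - of_nat (Suc k)) (nabla_iter X ?\<rho> k f) =
      nabla_iter X (\<gamma> + \<alpha> - of_nat (Suc k)) (Suc k) f"
    by (simp add: algebra_simps)
  have "(\<Sum>i=1..n. frac_kernel ?\<rho> ?\<mu> (a + of_nat n) (n - i) * nabla_iter X ?\<rho> k f (a + of_nat i)) =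
      nabla_iter X ?\<rho> k f a * norm_power (\<gamma> - 1) (a + of_nat n) n (- \<alpha> + of_nat k) +
      (\<Sum>i=1..n. frac_kernel (\<gamma> + \<alpha> - of_nat (Suc k)) (of_nat (Suc k) - \<alpha>) (a + of_nat n) (n - i) *
         nabla_iter X (\<gamma> + \<alpha> - of_nat (Suc k)) (Suc k) f (a + of_nat i))"
    using kernel_sum_by_parts[OF fin, of "nabla_iter X ?\<rho> k f", OF nz]
    unfolding args(1,2,3) iter unfolding args(4) by simp
  with Suc show ?case
    by (simp only: sum.lessThan_Suc Suc_leD add.assoc)
qed simp

end

section \<open>The solution formula\<close>

theorem theorem20:
  fixes X :: lattice and a \<gamma> \<alpha> :: complex and m :: nat and f g :: "complex \<Rightarrow> complex"
  assumes "nonuniform_lattice X"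
    and "0 < real m - 1" and "real m - 1 < Re \<alpha>" and "Re \<alpha> \<le> real m"
    and "\<forall>z\<in>points_after a. frac_sum_finite X a \<gamma> \<alpha> z"
    and "\<forall>k<m. nabla_iter_defined X (\<gamma> + \<alpha> - of_nat k) k a"
    and "\<forall>z\<in>points_after a. nabla_iter_defined X (\<gamma> + \<alpha> - of_nat m) m z"
    and "\<forall>z\<in>points_after a. frac_sum X a \<gamma> \<alpha> g z = f z"
  shows "\<forall>z\<in>points_after a.
    (\<forall>k<m. power_diff_finite X (\<gamma> - 1) z a (- \<alpha> + of_nat k)) \<and>
    frac_sum_finite X a (\<gamma> + \<alpha> - of_nat m) (of_nat m - \<alpha>) z \<longrightarrow>
    g z = (\<Sum>k = 0..m - 1. nabla_iter X (\<gamma> + \<alpha> - of_nat k) k f a *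
             (power_diff X (\<gamma> - 1) z a (- \<alpha> + of_nat k) / bracket_Gamma X (- \<alpha> + of_nat k + 1)))
        + frac_sum X a (\<gamma> + \<alpha> - of_nat m) (of_nat m - \<alpha>)
            (nabla_iter X (\<gamma> + \<alpha> - of_nat m) m f) z"
proof (intro ballI impI)
  interpret nonuniform X
    by unfold_locales fact
  fix z
  assume "z \<in> points_after a"
  then obtain n :: nat where z: "z = a + of_nat n" and n: "n \<ge> 1"
    by (auto simp: points_after_def)
  assume "(\<forall>k<m. power_diff_finite X (\<gamma> - 1) z a (- \<alpha> + of_nat k)) \<and>
    frac_sum_finite X a (\<gamma> + \<alpha> - of_nat m) (of_nat m - \<alpha>) z"
  then have pf: "\<And>k. k < m \<Longrightarrow> power_diff_finite X (\<gamma> - 1) (a + of_nat n) a (- \<alpha> + of_nat k)"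
    and ff: "frac_sum_finite X a (\<gamma> + \<alpha> - of_nat m) (of_nat m - \<alpha>) (a + of_nat n)"
    by (auto simp: z)
  have m: "m > 0" and \<alpha>: "\<alpha> \<noteq> 0"
    using assms(2,3) by auto
  have points: "a + of_nat i \<in> points_after a" if "i \<ge> 1" for i
    using that by (auto simp: points_after_def)
  \<comment> \<open>The last summand, t = z, of the fractional sum at a + i. There z - (t - 1) = 1,
    so its first Gamma argument is \<alpha>; its second one gives the finiteness on the
    diagonal.\<close>
  have pd: "power_diff_finite X (\<gamma> + \<alpha> - 1) (a + of_nat i) (a + of_nat i - 1) (\<alpha> - 1)" if "i \<ge> 1" for i
    using assms(5) points[OF that] points_upto_mem[of i i a] that \<alpha>
    by (auto simp: frac_sum_finite_def)
  have fin_\<alpha>: "fin \<alpha>"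
    using pd[of 1] by (simp add: power_diff_finite_def gen_power_finite_def)
  \<comment> \<open>Read off from the boundary power with k = 0.\<close>
  have fin_a: "fin (2 * a + of_nat n + \<gamma> + c)"
  proof -
    have "a + of_nat n + (\<gamma> - 1) / 2 + (a + (\<gamma> - 1) / 2) + c + 1 = 2 * a + of_nat n + \<gamma> + c"
      by (simp add: field_simps)
    then show ?thesis
      using pf[OF m] unfolding power_diff_finite_def gen_power_finite_def by (simp add: add_ac)
  qed
  have "g (a + of_nat n) =
      (\<Sum>i=1..n. frac_kernel (\<gamma> + \<alpha>) (- \<alpha>) (a + of_nat n) (n - i) * f (a + of_nat i))"
  proof (rule kernel_sum_inverse[symmetric, OF n fin_\<alpha> fin_a])
    fix l assume "l \<in> {1..n}"
    then have "l \<ge> 1"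
      by simp
    have eq: "a + of_nat l + (\<gamma> + \<alpha> - 1) / 2 + (a + of_nat l - 1 + (\<gamma> + \<alpha> - 1) / 2) + c + 1 =
        2 * a + 2 * of_nat l + \<gamma> + \<alpha> + c - 1"
      by (simp add: field_simps)
    show "fin (2 * a + 2 * of_nat l + \<gamma> + \<alpha> + c - 1)"
      using pd[OF \<open>l \<ge> 1\<close>] unfolding power_diff_finite_def gen_power_finite_def eq by (rule conjunct2)
  next
    fix i assume "i \<in> {1..n}"
    then have "i \<ge> 1"
      by simp
    with assms(5,8) points[OF this] \<alpha> show "f (a + of_nat i) =
        (\<Sum>l=1..i. frac_kernel \<gamma> \<alpha> (a + of_nat i) (i - l) * g (a + of_nat l))"
      using frac_sum_eq_kernel_sum[of a \<gamma> \<alpha> i g] by auto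
  qed
  also have "\<dots> = (\<Sum>k<m. nabla_iter X (\<gamma> + \<alpha> - of_nat k) k f a *
       norm_power (\<gamma> - 1) (a + of_nat n) n (- \<alpha> + of_nat k)) +
    (\<Sum>i=1..n. frac_kernel (\<gamma> + \<alpha> - of_nat m) (of_nat m - \<alpha>) (a + of_nat n) (n - i) *
       nabla_iter X (\<gamma> + \<alpha> - of_nat m) m f (a + of_nat i))"
    by (rule kernel_sum_Taylor[OF fin_a _ order.refl]) (use assms(7) points in auto)
  also have "(\<Sum>i=1..n. frac_kernel (\<gamma> + \<alpha> - of_nat m) (of_nat m - \<alpha>) (a + of_nat n) (n - i) *
       nabla_iter X (\<gamma> + \<alpha> - of_nat m) m f (a + of_nat i)) =
    frac_sum X a (\<gamma> + \<alpha> - of_nat m) (of_nat m - \<alpha>) (nabla_iter X (\<gamma> + \<alpha> - of_nat m) m f) (a + of_nat n)"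
  proof (rule frac_sum_eq_kernel_sum[symmetric, OF ff n])
    \<comment> \<open>For \<alpha> = m the remainder is the m-th difference itself, and the required
      finiteness follows from \<open>fin_a\<close> by a shift of n - 1.\<close>
    assume "of_nat m - \<alpha> = 0"
    then have "2 * (a + of_nat n) + (\<gamma> + \<alpha> - of_nat m) + c - 1 =
        2 * a + of_nat n + \<gamma> + c + of_nat (n - 1)"
      using n by (simp add: of_nat_diff algebra_simps)
    then show "fin (2 * (a + of_nat n) + (\<gamma> + \<alpha> - of_nat m) + c - 1)"
      using fin_plus_nat[OF fin_a, of "n - 1"] by (simp only:)
  qed
  also have "(\<Sum>k<m. nabla_iter X (\<gamma> + \<alpha> - of_nat k) k f a *
       norm_power (\<gamma> - 1) (a + of_nat n) n (- \<alpha> + of_nat k)) =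
    (\<Sum>k = 0..m - 1. nabla_iter X (\<gamma> + \<alpha> - of_nat k) k f a *
       (power_diff X (\<gamma> - 1) (a + of_nat n) a (- \<alpha> + of_nat k) / bracket_Gamma X (- \<alpha> + of_nat k + 1)))"
  proof (rule sum.cong)
    show "{..<m} = {0..m - 1}"
      using m by auto
    fix k assume "k \<in> {0..m - 1}"
    with m have "k < m"
      by auto
    from power_diff_eq_norm_power[OF pf[OF this], of n]
    show "nabla_iter X (\<gamma> + \<alpha> - of_nat k) k f a *
        norm_power (\<gamma> - 1) (a + of_nat n) n (- \<alpha> + of_nat k) =
      nabla_iter X (\<gamma> + \<alpha> - of_nat k) k f a *
        (power_diff X (\<gamma> - 1) (a + of_nat n) a (- \<alpha> + of_nat k) / bracket_Gamma X (- \<alpha> + of_nat k + 1))"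
      by simp
  qed
  finally show "g z = (\<Sum>k = 0..m - 1. nabla_iter X (\<gamma> + \<alpha> - of_nat k) k f a *
             (power_diff X (\<gamma> - 1) z a (- \<alpha> + of_nat k) / bracket_Gamma X (- \<alpha> + of_nat k + 1)))
        + frac_sum X a (\<gamma> + \<alpha> - of_nat m) (of_nat m - \<alpha>)
            (nabla_iter X (\<gamma> + \<alpha> - of_nat m) m f) z"
    unfolding z .
qed

end
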